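(* Let $\mathcal{H}=\mathcal{H}_1$ be a (uniformly convex) real Hilbert space, $\mathcal{H}_2$ a real Hilbert space, $g_1:\mathcal{H}_1\to\mathcal{H}_1$ a $\mu$-inverse strongly monotone mapping, $g_2:\mathcal{H}_2\to\mathcal{H}_2$ a $\nu$-inverse strongly monotone mapping ($\mu,\nu>0$), $\mathcal{B}_1:\mathcal{H}_1\to 2^{\mathcal{H}_1}$ and $\mathcal{B}_2:\mathcal{H}_2\to 2^{\mathcal{H}_2}$ maximal monotone mappings, and $\mathcal{A}:\mathcal{H}_1\to\mathcal{H}_2$ a bounded linear operator with adjoint $\mathcal{A}^*$. Let $\lambda>0$, $\gamma\in\left(0,\frac{2}{\|\mathcal{A}^*\mathcal{A}\|}\right)$ and put $$\mathcal{U}=\mathfrak{J}^{\mathcal{B}_1}_\lambda(I-\lambda g_1),\quad \mathcal{V}=\mathfrak{J}^{\mathcal{B}_2}_\lambda(I-\lambda g_2),\quad \mathfrak{J}'=\mathcal{U}\,(I+\gamma\mathcal{A}^*(\mathcal{V}-I)\mathcal{A}).$$ Suppose that $\mathcal{S}:\mathcal{H}\to\mathcal{H}$ and $\mathfrak{J}':\mathcal{H}\to\mathcal{H}$ are nonexpansive, that $\Sigma=\mathcal{F}(\mathcal{S})\cap\Omega\neq\emptyset$, and that $\mathcal{S}$ and $\mathfrak{J}'$ satisfy condition (B) on $\mathcal{H}$: there is a nondecreasing function $f:[0,\infty)\to[0,\infty)$ with $f(0)=0$ and $f(r)>0$ for $r>0$ such that, for all $x\in\mathcal{H}$, $$\max\{\|x-\mathcal{S}(x)\|,\|x-\mathfrak{J}'(x)\|\}\ge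 f(d(x,\Sigma)).$$ Let $x_0,x_1\in\mathcal{H}$ and let $\{x_n\}$ be generated, for $n\ge 1$, by $$w_n=x_n+\theta_n(x_n-x_{n-1}),\quad y_n=(1-\beta_n)w_n+\beta_n\mathcal{S}w_n,\quad x_{n+1}=(1-\alpha_n)\mathcal{S}y_n+\alpha_n\mathfrak{J}'y_n,$$ where: (D1) $\sum_{n=1}^{\infty}\theta_n<\infty$ and $\{\theta_n\}\subset[0,\theta]$ for some $0\le\theta<1$; (D2) $\{\alpha_n\},\{\beta_n\}\subset[\delta,1-\delta]$ for some $\delta\in(0,0.5)$; (D3) $\{\mathcal{S}(w_n)-w_n\}$ and $\{\mathcal{S}(w_n)-x^*\}$ are bounded for any $x^*\in\Sigma$; (D4) $\{\mathfrak{J}'(w_n)-w_n\}$ and $\{\mathfrak{J}'(w_n)-x^*\}$ are bounded for any $x^*\in\Sigma$. Then $\{x_n\}$ converges strongly to a common fixed point of $\mathcal{S}$ and $\mathfrak{J}'$.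
   Context: A mapping $\mathcal{S}:\mathcal{H}\to\mathcal{H}$ is nonexpansive if $\|\mathcal{S}x-\mathcal{S}y\|\le\|x-y\|$ for all $x,y$; $\mathcal{F}(\mathcal{S})=\{x\in\mathcal{H}:\mathcal{S}x=x\}$. A mapping $g$ is $\beta$-inverse strongly monotone ($\beta>0$) if $\langle g(x)-g(y),x-y\rangle\ge\beta\|g(x)-g(y)\|^2$ for all $x,y$. A set-valued $\mathcal{M}:\mathcal{H}\to2^{\mathcal{H}}$ is monotone if $\langle x-y,u-v\rangle\ge0$ whenever $u\in\mathcal{M}(x)$, $v\in\mathcal{M}(y)$, and maximal monotone if moreover its graph is not properly contained in the graph of another monotone set-valued mapping. The resolvent of a maximal monotone $\mathcal{M}$ with parameter $\lambda>0$ is the single-valued mapping $\mathfrak{J}^{\mathcal{M}}_\lambda=(I+\lambda\mathcal{M})^{-1}$ defined on all of $\mathcal{H}$. $I$ is the identity, and $d(x,\Sigma)=\inf_{y\in\Sigma}\|x-y\|$. $\Omega$ is the solution set of the split monotone inclusion problem: $$\Omega=\{x^*\in\mathcal{H}_1:\ 0\in g_1(x^* )+\mathcal{B}_1(x^* )\ \text{and}\ 0\in g_2(\mathcal{A}x^* )+\mathcal{B}_2(\mathcal{A}x^* )\}.$$ *)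

theory Defs
  imports "HOL-Analysis.Analysis"
begin

text \<open>
  A real Hilbert space is a type of sort \<open>{real_inner, complete_space}\<close>. A set-valued mapping is a
  function \<open>'a \<Rightarrow> 'a set\<close>, possibly with empty values.
\<close>

definition nonexpansive :: "('a::real_normed_vector \<Rightarrow> 'a) \<Rightarrow> bool" where
  "nonexpansive S \<longleftrightarrow> (\<forall>x y. norm (S x - S y) \<le> norm (x - y))"

definition fixed_points :: "('a \<Rightarrow> 'a) \<Rightarrow> 'a set" where
  "fixed_points S = {x. S x = x}"

definition inverse_strongly_monotone :: "real \<Rightarrow> ('a::real_inner \<Rightarrow> 'a) \<Rightarrow> bool" where
  "inverse_strongly_monotone \<beta> g \<longleftrightarrow>
     \<beta> > 0 \<and> (\<forall>x y. (g x - g y) \<bullet> (x - y) \<ge> \<beta> * (norm (g x - g y))\<^sup>2)"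

definition monotone_mapping :: "('a::real_inner \<Rightarrow> 'a set) \<Rightarrow> bool" where
  "monotone_mapping M \<longleftrightarrow> (\<forall>x y. \<forall>u\<in>M x. \<forall>v\<in>M y. (x - y) \<bullet> (u - v) \<ge> 0)"

definition graph_of :: "('a \<Rightarrow> 'a set) \<Rightarrow> ('a \<times> 'a) set" where
  "graph_of M = {(x, u). u \<in> M x}"

definition maximal_monotone :: "('a::real_inner \<Rightarrow> 'a set) \<Rightarrow> bool" where
  "maximal_monotone M \<longleftrightarrow>
     monotone_mapping M \<and> \<not> (\<exists>N. monotone_mapping N \<and> graph_of M \<subset> graph_of N)"

text \<open>
  The resolvent \<open>(I + lam M)\<^sup>-\<^sup>1\<close>: its value at \<open>x\<close> is the point \<open>y\<close> with \<open>x \<in> y + lam M(y)\<close>. For \<open>lam > 0\<close>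
  and \<open>M\<close> maximal monotone on a Hilbert space this point exists (Minty) and is unique, so the
  definite description is then proper at every \<open>x\<close>.
\<close>
definition resolvent :: "real \<Rightarrow> ('a::real_inner \<Rightarrow> 'a set) \<Rightarrow> 'a \<Rightarrow> 'a" where
  "resolvent lam M x = (THE y. x \<in> (\<lambda>u. y + lam *\<^sub>R u) ` M y)"

definition split_inclusion_solutions ::
  "('a::real_inner \<Rightarrow> 'a) \<Rightarrow> ('a \<Rightarrow> 'a set) \<Rightarrow> ('b::real_inner \<Rightarrow> 'b) \<Rightarrow> ('b \<Rightarrow> 'b set)
     \<Rightarrow> ('a \<Rightarrow> 'b) \<Rightarrow> 'a set" where
  "split_inclusion_solutions g1 B1 g2 B2 A =
     {x. 0 \<in> (\<lambda>u. g1 x + u) ` B1 x \<and> 0 \<in> (\<lambda>v. g2 (A x) + v) ` B2 (A x)}"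

text \<open>
  Only the values of \<open>f\<close> on \<open>[0,\<infinity>)\<close> matter. The distance \<open>d(x,\<Sigma>)\<close> is \<^const>\<open>infdist\<close>, which is the
  infimum of the distances for nonempty \<open>\<Sigma>\<close>.
\<close>
definition condition_B ::
  "('a::real_normed_vector \<Rightarrow> 'a) \<Rightarrow> ('a \<Rightarrow> 'a) \<Rightarrow> 'a set \<Rightarrow> bool" where
  "condition_B S T \<Sigma> \<longleftrightarrow>
     (\<exists>f :: real \<Rightarrow> real. f ` {0..} \<subseteq> {0..} \<and> mono_on {0..} f \<and> f 0 = 0 \<and> (\<forall>r>0. f r > 0) \<and>
        (\<forall>x. max (norm (x - S x)) (norm (x - T x)) \<ge> f (infdist x \<Sigma>)))"

end

theory Submission
  imports Defs
begin

text \<open>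
  Every point \<open>p\<close> of \<open>\<Sigma>\<close> is a common fixed point of \<open>S\<close> and \<open>J'\<close>. Since the inertial terms are
  summable, \<open>\<parallel>x\<^sub>n\<^sub>+\<^sub>1 - p\<parallel> \<le> \<parallel>x\<^sub>n - p\<parallel> + e\<^sub>n\<close> with \<open>e\<close> summable and independent of \<open>p\<close>, so these
  distances converge. The strict convexity defect of the square norm in the two averaging steps then
  forces \<open>w\<^sub>n - S w\<^sub>n\<close> and \<open>S y\<^sub>n - J' y\<^sub>n\<close> to tend to \<open>0\<close>, hence also \<open>x\<^sub>n - S x\<^sub>n\<close> and
  \<open>x\<^sub>n - J' x\<^sub>n\<close>. Condition (B) turns this into \<open>d(x\<^sub>n, \<Sigma>) \<longlonglongrightarrow> 0\<close>, and together with the quasi-Fejer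
  inequality this makes \<open>x\<close> a Cauchy sequence. That \<open>\<Sigma>\<close> is fixed by \<open>J'\<close> requires the adjoint of \<open>A\<close>
  to exist, which is the Riesz representation theorem.
\<close>

section \<open>Riesz representation and the Hilbert space adjoint\<close>

lemma Riesz_representation:
  fixes f :: "'a::{real_inner, complete_space} \<Rightarrow> real"
  assumes "bounded_linear f"
  shows "\<exists>z. \<forall>x. f x = x \<bullet> z"
proof -
  interpret f: bounded_linear f by fact
  \<comment> \<open>The representing vector is the minimiser of this functional.\<close>
  define \<phi> where "\<phi> x = x \<bullet> x - 2 * f x" for x
  obtain K where K: "\<And>x. norm (f x) \<le> norm x * K" using f.bounded by blast
  have lower: "\<phi> x \<ge> - K\<^sup>2" for x
  proof -
    have "f x \<le> norm x * K" using K[of x] by simp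
    moreover have "(norm x - K)\<^sup>2 \<ge> 0" by simp
    moreover have "x \<bullet> x = (norm x)\<^sup>2" by (simp add: power2_norm_eq_inner)
    ultimately show ?thesis unfolding \<phi>_def by (simp add: power2_diff)
  qed
  define m where "m = Inf (range \<phi>)"
  have bdd: "bdd_below (range \<phi>)" using lower by (auto intro!: bdd_belowI)
  have m_le: "m \<le> \<phi> x" for x unfolding m_def using bdd by (simp add: cInf_lower)
  have "\<exists>x. \<phi> x < m + 1 / real (Suc n)" for n
    using cInf_less_iff[OF _ bdd, of "m + 1 / real (Suc n)"] by (auto simp: m_def)
  then obtain X where X: "\<And>n. \<phi> (X n) < m + 1 / real (Suc n)" by metis
  \<comment> \<open>Parallelogram law: the linear terms cancel. Since \<open>\<phi>\<close> is at
    least \<open>m\<close> at the midpoint, points that nearly attain \<open>m\<close> are close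
    together.\<close>
  have par: "(norm (x - y))\<^sup>2 = 2 * \<phi> x + 2 * \<phi> y - 4 * \<phi> ((1/2) *\<^sub>R (x + y))" for x y
    unfolding \<phi>_def power2_norm_eq_inner
    by (simp add: f.add f.scaleR inner_simps inner_commute field_simps)
  have "Cauchy X"
  proof (rule metric_CauchyI)
    fix e :: real assume e: "e > 0"
    then obtain N where N: "1 / real (Suc N) < e\<^sup>2 / 4"
      using nat_approx_posE[of "e\<^sup>2 / 4"] by (auto simp: inverse_eq_divide)
    have "dist (X i) (X j) < e" if "i \<ge> N" "j \<ge> N" for i j
    proof -
      have "1 / real (Suc i) \<le> 1 / real (Suc N)" "1 / real (Suc j) \<le> 1 / real (Suc N)"
        using that by (auto intro!: divide_left_mono)
      then have "(norm (X i - X j))\<^sup>2 < e\<^sup>2"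
        using par[of "X i" "X j"] X[of i] X[of j] m_le[of "(1/2) *\<^sub>R (X i + X j)"] N by linarith
      then show ?thesis using e by (simp add: dist_norm power2_less_imp_less)
    qed
    then show "\<exists>M. \<forall>i\<ge>M. \<forall>j\<ge>M. dist (X i) (X j) < e" by blast
  qed
  then obtain z where z: "X \<longlonglongrightarrow> z" using Cauchy_convergent convergent_def by blast
  have "(\<lambda>n. \<phi> (X n)) \<longlonglongrightarrow> \<phi> z"
    unfolding \<phi>_def by (intro tendsto_intros f.tendsto z)
  moreover have "(\<lambda>n. m + 1 / real (Suc n)) \<longlonglongrightarrow> m + 0"
    by (intro tendsto_intros LIMSEQ_Suc[OF lim_1_over_n])
  ultimately have "\<phi> z \<le> m"
    using X by (intro LIMSEQ_le[of _ "\<phi> z" _ m]) (auto intro: less_imp_le)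
  have "f x = x \<bullet> z" for x
  proof (cases "x = 0")
    case False
    define c where "c = x \<bullet> z - f x"
    define q where "q = x \<bullet> x"
    have q: "q > 0" using False by (simp add: q_def)
    have "\<phi> (z + s *\<^sub>R x) = \<phi> z + s\<^sup>2 * q + 2 * s * c" for s
      unfolding \<phi>_def c_def q_def
      by (simp add: f.add f.scaleR inner_simps inner_commute power2_eq_square algebra_simps)
    \<comment> \<open>\<open>- c / q\<close> is the vertex of the quadratic in \<open>s\<close>; its
      depth \<open>c\<^sup>2 / q\<close> must vanish because \<open>z\<close> is a
      minimiser.\<close>
    then have "\<phi> (z + (- (c / q)) *\<^sub>R x) = \<phi> z + (- (c / q))\<^sup>2 * q + 2 * (- (c / q)) * c"
      by blast
    also have "\<dots> = \<phi> z - c\<^sup>2 / q"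
      using q by (simp add: power2_eq_square field_simps)
    finally have "\<phi> z \<le> \<phi> z - c\<^sup>2 / q"
      using \<open>\<phi> z \<le> m\<close> m_le[of "z + (- (c / q)) *\<^sub>R x"] by linarith
    then have "c\<^sup>2 / q \<le> 0" by simp
    then have "c = 0" using q by (simp add: divide_le_0_iff)
    then show ?thesis by (simp add: c_def)
  qed (simp add: f.zero)
  then show ?thesis by blast
qed

text \<open>The library proves this only for Euclidean spaces.\<close>

lemma adjoint_inner_Hilbert:
  fixes A :: "'a::{real_inner, complete_space} \<Rightarrow> 'b::real_inner"
  assumes "bounded_linear A"
  shows "A x \<bullet> y = x \<bullet> adjoint A y"
proof -
  have "bounded_linear (\<lambda>x. A x \<bullet> y)" for y
    using assms by (intro bounded_linear_intros)
  then have "\<forall>y. \<exists>z. \<forall>x. A x \<bullet> y = x \<bullet> z" by (blast dest: Riesz_representation)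
  then obtain A' where "\<forall>x y. A x \<bullet> y = x \<bullet> A' y" by metis
  then show ?thesis
    unfolding adjoint_def using someI[where P = "\<lambda>A'. \<forall>x y. A x \<bullet> y = x \<bullet> A' y"] by blast
qed

text \<open>\<open>adjoint A 0\<close> is orthogonal to itself by the adjoint identity. This makes
  the correction term of \<open>J'\<close> vanish at points of \<open>\<Sigma>\<close>.\<close>

lemma adjoint_zero_Hilbert:
  fixes A :: "'a::{real_inner, complete_space} \<Rightarrow> 'b::real_inner"
  assumes "bounded_linear A"
  shows "adjoint A 0 = 0"
  using adjoint_inner_Hilbert[OF assms, of "adjoint A 0" 0] by (metis inner_eq_zero_iff inner_zero_right)

section \<open>Resolvents and fixed points\<close>

text \<open>The element \<open>u\<close> supplies the candidate \<open>p\<close>. For any other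
  candidate \<open>q\<close> with \<open>v\<close> in \<open>M q\<close>, monotonicity bounds
  \<open>- lam * ((u - v) \<bullet> (u - v))\<close> below by 0, so \<open>u = v\<close> and
  \<open>q = p\<close>.\<close>

lemma resolvent_eqI:
  assumes M: "monotone_mapping M" and "lam > 0" and u: "u \<in> M p"
  shows "resolvent lam M (p + lam *\<^sub>R u) = p"
  unfolding resolvent_def
proof (rule the_equality)
  show "p + lam *\<^sub>R u \<in> (\<lambda>u. p + lam *\<^sub>R u) ` M p" using u by blast
next
  fix q assume "p + lam *\<^sub>R u \<in> (\<lambda>u. q + lam *\<^sub>R u) ` M q"
  then obtain v where v: "v \<in> M q" and "p + lam *\<^sub>R u = q + lam *\<^sub>R v" by blast
  then have q: "q - p = lam *\<^sub>R (u - v)" by (simp add: algebra_simps)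
  have "(q - p) \<bullet> (v - u) \<ge> 0" using M u v by (auto simp: monotone_mapping_def)
  moreover have "(q - p) \<bullet> (v - u) = - (lam * ((u - v) \<bullet> (u - v)))"
    unfolding q by (simp add: inner_simps inner_commute algebra_simps)
  ultimately have "lam * ((u - v) \<bullet> (u - v)) \<le> 0" by simp
  then have "(u - v) \<bullet> (u - v) \<le> 0" using \<open>lam > 0\<close> by (simp add: mult_le_0_iff)
  then have "u - v = 0" by (metis inner_eq_zero_iff inner_ge_zero order_antisym)
  then show "q = p" using q by simp
qed

text \<open>The inclusion says that \<open>- g p\<close> lies in \<open>M p\<close>, so the forward
  step has the form \<open>p + lam *\<^sub>R u\<close> with \<open>u\<close> in
  \<open>M p\<close>.\<close>

lemma resolvent_forward_step_fixed:
  assumes "monotone_mapping M" "lam > 0" "0 \<in> (\<lambda>u. g p + u) ` M p"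
  shows "resolvent lam M (p - lam *\<^sub>R g p) = p"
proof -
  obtain u where "u \<in> M p" "g p = - u" using assms(3) by (auto simp: eq_neg_iff_add_eq_0)
  then show ?thesis using resolvent_eqI[OF assms(1,2)] by simp
qed

section \<open>Strict convexity of the squared norm\<close>

lemma norm_convex_combination_sq:
  fixes a b :: "'a::real_inner"
  shows "(norm ((1 - t) *\<^sub>R a + t *\<^sub>R b))\<^sup>2
    = (1 - t) * (norm a)\<^sup>2 + t * (norm b)\<^sup>2 - t * (1 - t) * (norm (a - b))\<^sup>2"
  unfolding power2_norm_eq_inner
  by (simp add: inner_simps inner_commute algebra_simps)

text \<open>The convexity defect carries the factor \<open>t * (1 - t)\<close>, and both factors are
  at least \<open>\<delta>\<close>.\<close>

lemma averaged_step_decrease: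
  fixes a b p :: "'a::real_inner"
  assumes t: "t \<in> {\<delta>..1 - \<delta>}" and "\<delta> > 0"
    and ab: "norm (a - p) \<le> r" "norm (b - p) \<le> r"
  shows "(norm ((1 - t) *\<^sub>R a + t *\<^sub>R b - p))\<^sup>2 \<le> r\<^sup>2 - \<delta>\<^sup>2 * (norm (a - b))\<^sup>2"
proof -
  have "(1 - t) * (norm (a - p))\<^sup>2 + t * (norm (b - p))\<^sup>2 \<le> (1 - t) * r\<^sup>2 + t * r\<^sup>2"
    using t \<open>\<delta> > 0\<close> ab by (intro add_mono mult_left_mono power_mono) auto
  moreover have "\<delta> * \<delta> * (norm (a - b))\<^sup>2 \<le> t * (1 - t) * (norm (a - b))\<^sup>2"
    using t \<open>\<delta> > 0\<close> by (intro mult_right_mono mult_mono) auto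
  moreover have "(norm ((1 - t) *\<^sub>R a + t *\<^sub>R b - p))\<^sup>2
      = (1 - t) * (norm (a - p))\<^sup>2 + t * (norm (b - p))\<^sup>2 - t * (1 - t) * (norm (a - b))\<^sup>2"
    using norm_convex_combination_sq[of t "a - p" "b - p"] by (simp add: algebra_simps)
  moreover have "(1 - t) * r\<^sup>2 + t * r\<^sup>2 = r\<^sup>2" by (simp add: algebra_simps)
  ultimately show ?thesis by (simp only: power2_eq_square[of \<delta>])
qed

section \<open>Quasi-Fejer sequences and gauges\<close>

text \<open>Subtracting the partial sums of \<open>e\<close> leaves a decreasing sequence, bounded
  below because those sums are bounded.\<close>

lemma convergent_summable_perturbation:
  fixes a e :: "nat \<Rightarrow> real"
  assumes nonneg: "\<And>n. 0 \<le> a n" and step: "\<And>n. a (Suc n) \<le> a n + e n" and e: "summable e"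
  shows "convergent a"
proof -
  define b where "b n = a n - sum e {..<n}" for n
  have conv_e: "convergent (\<lambda>n. sum e {..<n})" using e by (simp add: summable_iff_convergent)
  then obtain K where K: "\<And>n. \<bar>sum e {..<n}\<bar> \<le> K"
    using convergent_imp_Bseq[OF conv_e] by (auto simp: Bseq_def)
  have "decseq b" using step by (intro decseq_SucI) (simp add: b_def algebra_simps)
  moreover have "- K \<le> b n" for n using K[of n] nonneg[of n] by (simp add: b_def)
  ultimately obtain L where "b \<longlonglongrightarrow> L" using decseq_convergent[of b "- K"] by blast
  then have "convergent (\<lambda>n. b n + sum e {..<n})"
    using conv_e by (intro convergent_add) (auto simp: convergent_def)
  then show ?thesis by (simp add: b_def)
qed

text \<open>Once the tails of \<open>e\<close> and the distance to \<open>F\<close> are below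
  \<open>r / 4\<close>, some \<open>p\<close> in \<open>F\<close> is within \<open>r / 4\<close> of
  \<open>X N\<close>, and all later terms stay within \<open>r / 2\<close> of it. As
  \<open>p\<close> depends on \<open>N\<close>, the errors must not depend on
  \<open>p\<close>.\<close>

lemma quasi_Fejer_Cauchy:
  fixes X :: "nat \<Rightarrow> 'a::real_normed_vector"
  assumes step: "\<And>p n. p \<in> F \<Longrightarrow> norm (X (Suc n) - p) \<le> norm (X n - p) + e n"
    and e: "summable e" and F: "F \<noteq> {}" and dist: "(\<lambda>n. infdist (X n) F) \<longlonglongrightarrow> 0"
  shows "Cauchy X"
proof (rule metric_CauchyI)
  fix r :: real assume r: "r > 0"
  obtain N\<^sub>1 where N\<^sub>1: "\<And>m n. m \<ge> N\<^sub>1 \<Longrightarrow> norm (sum e {m..<n}) < r / 4"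
    using e r unfolding summable_Cauchy by (meson zero_less_divide_iff zero_less_numeral)
  have "\<forall>\<^sub>F n in sequentially. infdist (X n) F < r / 4"
    using order_tendstoD(2)[OF dist, of "r / 4"] r by simp
  then obtain N\<^sub>2 where N\<^sub>2: "\<And>n. n \<ge> N\<^sub>2 \<Longrightarrow> infdist (X n) F < r / 4"
    by (auto simp: eventually_sequentially)
  define N where "N = max N\<^sub>1 N\<^sub>2"
  obtain p where p: "p \<in> F" "dist (X N) p < r / 4"
    using N\<^sub>2[of N] F cINF_less_iff[of F "dist (X N)" "r / 4"]
    by (auto simp: N_def infdist_notempty)
  have "norm (X n - p) \<le> norm (X N - p) + sum e {N..<n}" if "n \<ge> N" for n
    using that
  proof (induction rule: dec_induct)
    case (step n)
    then show ?case using assms(1)[OF p(1), of n] by simp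
  qed simp
  then have near: "dist (X n) p < r / 2" if "n \<ge> N" for n
    using that p(2) N\<^sub>1[of N n] by (fastforce simp: N_def dist_norm)
  have "dist (X i) (X j) < r" if "i \<ge> N" "j \<ge> N" for i j
    using near[OF that(1)] near[OF that(2)] by (rule dist_triangle_half_l)
  then show "\<exists>M. \<forall>i\<ge>M. \<forall>j\<ge>M. dist (X i) (X j) < r" by blast
qed

text \<open>If \<open>d n \<ge> r\<close>, then \<open>f r \<le> f (d n) \<le> b n\<close>, which
  fails once \<open>b n\<close> drops below \<open>f r\<close>.\<close>

lemma tendsto_zero_of_mono_gauge:
  fixes f :: "real \<Rightarrow> real" and d :: "nat \<Rightarrow> real"
  assumes f: "mono_on {0..} f" "\<And>r. r > 0 \<Longrightarrow> f r > 0"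
    and d: "\<And>n. 0 \<le> d n" and lim: "b \<longlonglongrightarrow> 0" and le: "\<And>n. f (d n) \<le> b n"
  shows "d \<longlonglongrightarrow> 0"
proof (rule LIMSEQ_I)
  fix r :: real assume r: "r > 0"
  have "\<forall>\<^sub>F n in sequentially. b n < f r" using lim f(2)[OF r] by (rule order_tendstoD(2))
  moreover have "d n < r" if "b n < f r" for n
  proof (rule ccontr)
    assume "\<not> d n < r"
    then have "f r \<le> f (d n)" using r d by (intro mono_onD[OF f(1)]) auto
    then show False using that le[of n] by simp
  qed
  ultimately show "\<exists>no. \<forall>n\<ge>no. norm (d n - 0) < r"
    using d by (auto simp: eventually_sequentially)
qed

text \<open>Carries a small residual from \<open>v\<close> to a nearby \<open>u\<close>: one
  \<open>norm (u - v)\<close> pays for moving the point, the other for moving its image.\<close>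

lemma residual_le:
  assumes "nonexpansive T"
  shows "norm (u - T u) \<le> 2 * norm (u - v) + norm (v - T v)"
proof -
  have "u - T u = (u - v) + (v - T v) + (T v - T u)" by simp
  moreover have "norm (T v - T u) \<le> norm (u - v)"
    using assms by (simp add: nonexpansive_def norm_minus_commute)
  ultimately show ?thesis
    using norm_triangle_ineq[of "u - v + (v - T v)" "T v - T u"]
      norm_triangle_ineq[of "u - v" "v - T v"] by (smt (verit))
qed

lemma limit_of_residual_zero_fixed:
  assumes T: "nonexpansive T" and X: "X \<longlonglongrightarrow> q" and res: "(\<lambda>n. norm (X n - T (X n))) \<longlonglongrightarrow> 0"
  shows "q \<in> fixed_points T"
proof -
  have "(\<lambda>n. 2 * norm (q - X n) + norm (X n - T (X n))) \<longlonglongrightarrow> 2 * norm (q - q) + 0"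
    by (intro tendsto_intros X res)
  then have "norm (q - T q) \<le> 2 * norm (q - q) + 0"
    using residual_le[OF T] by (intro LIMSEQ_le_const) blast+
  then show ?thesis by (simp add: fixed_points_def)
qed

lemma tendsto_zero_of_sq_bound:
  fixes a b :: "nat \<Rightarrow> real"
  assumes "c > 0" and "b \<longlonglongrightarrow> 0" and "\<And>n. c * (a n)\<^sup>2 \<le> b n"
  shows "a \<longlonglongrightarrow> 0"
proof -
  have "(\<lambda>n. c * (a n)\<^sup>2) \<longlonglongrightarrow> 0"
  proof (rule tendsto_sandwich[OF _ _ tendsto_const assms(2)])
    show "\<forall>\<^sub>F n in sequentially. 0 \<le> c * (a n)\<^sup>2" using \<open>c > 0\<close> by simp
    show "\<forall>\<^sub>F n in sequentially. c * (a n)\<^sup>2 \<le> b n" using assms(3) by simp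
  qed
  then have "(\<lambda>n. (1 / c) * (c * (a n)\<^sup>2)) \<longlonglongrightarrow> (1 / c) * 0" by (intro tendsto_intros)
  then have "(\<lambda>n. (a n)\<^sup>2) \<longlonglongrightarrow> 0" using \<open>c > 0\<close> by simp
  then show ?thesis by simp
qed

section \<open>Strong convergence of the inertial iteration\<close>

theorem theorem3p3:
  fixes g1 :: "'a::{real_inner, complete_space} \<Rightarrow> 'a"
    and g2 :: "'b::{real_inner, complete_space} \<Rightarrow> 'b"
    and B1 :: "'a \<Rightarrow> 'a set"
    and B2 :: "'b \<Rightarrow> 'b set"
    and A :: "'a \<Rightarrow> 'b"
    and S U J' :: "'a \<Rightarrow> 'a"
    and V :: "'b \<Rightarrow> 'b"
    and \<Sigma> :: "'a set"
    and x w y :: "nat \<Rightarrow> 'a"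
    and \<alpha> \<beta> \<theta> :: "nat \<Rightarrow> real"
    and \<mu> \<nu> lam \<gamma> \<delta> \<theta>\<^sub>0 :: real
  assumes g1: "inverse_strongly_monotone \<mu> g1"
    and g2: "inverse_strongly_monotone \<nu> g2"
    and B1: "maximal_monotone B1"
    and B2: "maximal_monotone B2"
    and A: "bounded_linear A"
    and lambda: "lam > 0"
    and gamma_pos: "\<gamma> > 0"
    and gamma_less: "onorm (adjoint A \<circ> A) \<noteq> 0 \<longrightarrow> \<gamma> < 2 / onorm (adjoint A \<circ> A)"
    and U: "U = (\<lambda>z. resolvent lam B1 (z - lam *\<^sub>R g1 z))"
    and V: "V = (\<lambda>z. resolvent lam B2 (z - lam *\<^sub>R g2 z))"
    and J': "J' = (\<lambda>z. U (z + \<gamma> *\<^sub>R adjoint A (V (A z) - A z)))"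
    and S_nonexp: "nonexpansive S"
    and J'_nonexp: "nonexpansive J'"
    and \<Sigma>: "\<Sigma> = fixed_points S \<inter> split_inclusion_solutions g1 B1 g2 B2 A"
    and \<Sigma>_nonempty: "\<Sigma> \<noteq> {}"
    and condB: "condition_B S J' \<Sigma>"
    and w: "\<And>n. n \<ge> 1 \<Longrightarrow> w n = x n + \<theta> n *\<^sub>R (x n - x (n - 1))"
    and y: "\<And>n. n \<ge> 1 \<Longrightarrow> y n = (1 - \<beta> n) *\<^sub>R w n + \<beta> n *\<^sub>R S (w n)"
    and x: "\<And>n. n \<ge> 1 \<Longrightarrow> x (n + 1) = (1 - \<alpha> n) *\<^sub>R S (y n) + \<alpha> n *\<^sub>R J' (y n)"
    and D1_summable: "summable (\<lambda>n. \<theta> (n + 1))"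
    and D1_bound: "0 \<le> \<theta>\<^sub>0" "\<theta>\<^sub>0 < 1" "\<And>n. n \<ge> 1 \<Longrightarrow> \<theta> n \<in> {0..\<theta>\<^sub>0}"
    and D2: "\<delta> \<in> {0<..<1/2}"
      "\<And>n. n \<ge> 1 \<Longrightarrow> \<alpha> n \<in> {\<delta>..1 - \<delta>}"
      "\<And>n. n \<ge> 1 \<Longrightarrow> \<beta> n \<in> {\<delta>..1 - \<delta>}"
    and D3: "bounded ((\<lambda>n. S (w n) - w n) ` {1..})"
      "\<And>p. p \<in> \<Sigma> \<Longrightarrow> bounded ((\<lambda>n. S (w n) - p) ` {1..})"
    and D4: "bounded ((\<lambda>n. J' (w n) - w n) ` {1..})"
      "\<And>p. p \<in> \<Sigma> \<Longrightarrow> bounded ((\<lambda>n. J' (w n) - p) ` {1..})"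
  shows "\<exists>p \<in> fixed_points S \<inter> fixed_points J'. x \<longlonglongrightarrow> p"
proof -
  have fixed: "S p = p" "J' p = p" if "p \<in> \<Sigma>" for p
  proof -
    have "0 \<in> (\<lambda>u. g1 p + u) ` B1 p" "0 \<in> (\<lambda>v. g2 (A p) + v) ` B2 (A p)"
      using that by (auto simp: \<Sigma> split_inclusion_solutions_def)
    then have "U p = p" "V (A p) = A p"
      using B1 B2 lambda unfolding U V maximal_monotone_def
      by (auto intro: resolvent_forward_step_fixed)
    then show "J' p = p" unfolding J' by (simp add: adjoint_zero_Hilbert[OF A])
    show "S p = p" using that by (simp add: \<Sigma> fixed_points_def)
  qed
  have Sp: "norm (S z - p) \<le> norm (z - p)" if "p \<in> \<Sigma>" for z p
    using S_nonexp fixed(1)[OF that] by (metis nonexpansive_def)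
  have Jp: "norm (J' z - p) \<le> norm (z - p)" if "p \<in> \<Sigma>" for z p
    using J'_nonexp fixed(2)[OF that] by (metis nonexpansive_def)

  \<comment> \<open>The recursion starts at index \<open>1\<close>, so the sequences are shifted.\<close>
  define X where "X n = x (Suc n)" for n
  define W where "W n = w (Suc n)" for n
  define Y where "Y n = y (Suc n)" for n
  have WX: "W n - X n = \<theta> (Suc n) *\<^sub>R (X n - x n)" for n
    using w[of "Suc n"] by (simp add: W_def X_def)
  have Y: "Y n = (1 - \<beta> (Suc n)) *\<^sub>R W n + \<beta> (Suc n) *\<^sub>R S (W n)" for n
    using y[of "Suc n"] by (simp add: W_def Y_def)
  have XS: "X (Suc n) = (1 - \<alpha> (Suc n)) *\<^sub>R S (Y n) + \<alpha> (Suc n) *\<^sub>R J' (Y n)" for n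
    using x[of "Suc n"] by (simp add: X_def Y_def)
  have \<delta>: "\<delta> > 0" using D2(1) by simp
  have \<beta>: "\<beta> (Suc n) \<in> {\<delta>..1 - \<delta>}" and \<alpha>: "\<alpha> (Suc n) \<in> {\<delta>..1 - \<delta>}"
    and \<theta>: "\<theta> (Suc n) \<ge> 0" for n
    using D2(2)[of "Suc n"] D2(3)[of "Suc n"] D1_bound(3)[of "Suc n"] by auto

  \<comment> \<open>Descent inequalities for the two averaging steps\<close>
  have YW: "(norm (Y n - p))\<^sup>2 \<le> (norm (W n - p))\<^sup>2 - \<delta>\<^sup>2 * (norm (W n - S (W n)))\<^sup>2"
    if "p \<in> \<Sigma>" for p n
    unfolding Y by (rule averaged_step_decrease[OF \<beta> \<delta> order_refl Sp[OF that]])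
  have XY: "(norm (X (Suc n) - p))\<^sup>2 \<le> (norm (Y n - p))\<^sup>2 - \<delta>\<^sup>2 * (norm (S (Y n) - J' (Y n)))\<^sup>2"
    if "p \<in> \<Sigma>" for p n
    unfolding XS by (rule averaged_step_decrease[OF \<alpha> \<delta> Sp[OF that] Jp[OF that]])
  have XW: "norm (X (Suc n) - p) \<le> norm (W n - p)" if "p \<in> \<Sigma>" for p n
  proof (rule power2_le_imp_le)
    have "0 \<le> \<delta>\<^sup>2 * (norm (W n - S (W n)))\<^sup>2" "0 \<le> \<delta>\<^sup>2 * (norm (S (Y n) - J' (Y n)))\<^sup>2" by simp_all
    then show "(norm (X (Suc n) - p))\<^sup>2 \<le> (norm (W n - p))\<^sup>2"
      using YW[OF that, of n] XY[OF that, of n] by linarith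
  qed simp

  obtain p\<^sub>0 where p\<^sub>0: "p\<^sub>0 \<in> \<Sigma>" using \<Sigma>_nonempty by blast
  obtain C\<^sub>1 C\<^sub>2 where "\<And>n. n \<ge> 1 \<Longrightarrow> norm (S (w n) - w n) \<le> C\<^sub>1"
    "\<And>n. n \<ge> 1 \<Longrightarrow> norm (S (w n) - p\<^sub>0) \<le> C\<^sub>2"
    using D3(1) D3(2)[OF p\<^sub>0] by (force simp: bounded_iff)
  then have C: "norm (S (W n) - W n) \<le> C\<^sub>1" "norm (S (W n) - p\<^sub>0) \<le> C\<^sub>2" for n
    by (simp_all add: W_def)
  \<comment> \<open>Writes \<open>W n - p\<^sub>0\<close> as the difference of the two sequences
    bounded in D3.\<close>
  have Wb: "norm (W n - p\<^sub>0) \<le> C\<^sub>1 + C\<^sub>2" for n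
    using norm_triangle_ineq4[of "S (W n) - p\<^sub>0" "S (W n) - W n"] C[of n] by simp
  \<comment> \<open>Iterates from index 2 on are controlled by \<open>W\<close>; the starting points
    \<open>x 0\<close> and \<open>x 1\<close> are free and enter separately.\<close>
  define C where "C = max (C\<^sub>1 + C\<^sub>2) (max (norm (x 0 - p\<^sub>0)) (norm (x 1 - p\<^sub>0)))"
  have xb: "norm (x n - p\<^sub>0) \<le> C" for n
  proof (cases "n \<le> 1")
    case True
    then have "n = 0 \<or> n = 1" by auto
    then show ?thesis by (auto simp: C_def)
  next
    case False
    then obtain k where "n = Suc (Suc k)" by (metis One_nat_def not_less_eq_eq old.nat.exhaust zero_le)
    then show ?thesis using XW[OF p\<^sub>0, of k] Wb[of k] by (simp add: X_def C_def)
  qed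

  \<comment> \<open>Consecutive iterates are at most \<open>2 * C\<close> apart, so this bounds the
    inertial displacement with no reference to the point \<open>p\<close>.\<close>
  define e where "e n = \<theta> (Suc n) * (2 * C)" for n
  have e: "summable e" using D1_summable unfolding e_def by (auto intro: summable_mult2)
  have WXe: "norm (W n - X n) \<le> e n" for n
  proof -
    have "norm (X n - x n) \<le> 2 * C"
      using norm_triangle_ineq4[of "X n - p\<^sub>0" "x n - p\<^sub>0"] xb[of n] xb[of "Suc n"]
      by (simp add: X_def)
    then show ?thesis unfolding WX e_def using \<theta> by (simp add: mult_left_mono)
  qed
  have Wp: "norm (W n - p) \<le> norm (X n - p) + e n" for n p
    using norm_triangle_ineq[of "W n - X n" "X n - p"] WXe[of n] by simp
  have Fejer: "norm (X (Suc n) - p) \<le> norm (X n - p) + e n" if "p \<in> \<Sigma>" for n p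
    using XW[OF that] Wp by (rule order_trans)

  \<comment> \<open>Vanishing residuals\<close>
  define a where "a n = norm (X n - p\<^sub>0)" for n
  have "convergent a"
    using Fejer[OF p\<^sub>0] e by (intro convergent_summable_perturbation[of a e]) (auto simp: a_def)
  then obtain L where a: "a \<longlonglongrightarrow> L" by (auto simp: convergent_def)
  have e0: "e \<longlonglongrightarrow> 0" using e by (rule summable_LIMSEQ_zero)
  \<comment> \<open>Both squares tend to \<open>L\<^sup>2\<close>. This difference dominates the sum
    of the two convexity defects, so dropping either one bounds the other.\<close>
  have gap: "(\<lambda>n. (a n + e n)\<^sup>2 - (a (Suc n))\<^sup>2) \<longlonglongrightarrow> 0"
    using tendsto_diff[OF tendsto_power[OF tendsto_add[OF a e0], of 2]
        tendsto_power[OF LIMSEQ_Suc[OF a], of 2]] by simp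
  have Wsq: "(norm (W n - p\<^sub>0))\<^sup>2 \<le> (a n + e n)\<^sup>2" for n
    using Wp by (intro power_mono) (auto simp: a_def)
  have W_res: "(\<lambda>n. norm (W n - S (W n))) \<longlonglongrightarrow> 0"
  proof (rule tendsto_zero_of_sq_bound[OF _ gap])
    fix n
    have "0 \<le> \<delta>\<^sup>2 * (norm (S (Y n) - J' (Y n)))\<^sup>2" by simp
    then show "\<delta>\<^sup>2 * (norm (W n - S (W n)))\<^sup>2 \<le> (a n + e n)\<^sup>2 - (a (Suc n))\<^sup>2"
      using YW[OF p\<^sub>0, of n] XY[OF p\<^sub>0, of n] Wsq[of n] unfolding a_def by linarith
  qed (use \<delta> in simp)
  have Y_gap: "(\<lambda>n. norm (S (Y n) - J' (Y n))) \<longlonglongrightarrow> 0"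
  proof (rule tendsto_zero_of_sq_bound[OF _ gap])
    fix n
    have "0 \<le> \<delta>\<^sup>2 * (norm (W n - S (W n)))\<^sup>2" by simp
    then show "\<delta>\<^sup>2 * (norm (S (Y n) - J' (Y n)))\<^sup>2 \<le> (a n + e n)\<^sup>2 - (a (Suc n))\<^sup>2"
      using YW[OF p\<^sub>0, of n] XY[OF p\<^sub>0, of n] Wsq[of n] unfolding a_def by linarith
  qed (use \<delta> in simp)

  have XW_le: "norm (X n - W n) \<le> e n" for n using WXe by (simp add: norm_minus_commute)
  have YW_le: "norm (Y n - W n) \<le> norm (W n - S (W n))" for n
  proof -
    have "Y n - W n = \<beta> (Suc n) *\<^sub>R (S (W n) - W n)" unfolding Y by (simp add: algebra_simps)
    then show ?thesis
      using \<beta>[of n] \<delta> by (simp add: norm_minus_commute mult_left_le_one_le)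
  qed
  have X_res_S: "(\<lambda>n. norm (X n - S (X n))) \<longlonglongrightarrow> 0"
  proof (rule tendsto_sandwich[OF _ _ tendsto_const])
    show "(\<lambda>n. 2 * e n + norm (W n - S (W n))) \<longlonglongrightarrow> 0"
      using tendsto_add[OF tendsto_mult[OF tendsto_const e0] W_res, of 2] by simp
    show "\<forall>\<^sub>F n in sequentially. norm (X n - S (X n)) \<le> 2 * e n + norm (W n - S (W n))"
      using residual_le[OF S_nonexp, of "X _" "W _"] XW_le
      by (intro always_eventually allI) (smt (verit))
  qed simp
  have X_res_J: "(\<lambda>n. norm (X n - J' (X n))) \<longlonglongrightarrow> 0"
  proof (rule tendsto_sandwich[OF _ _ tendsto_const])
    show "(\<lambda>n. 2 * e n + 5 * norm (W n - S (W n)) + norm (S (Y n) - J' (Y n))) \<longlonglongrightarrow> 0"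
      using tendsto_add[OF tendsto_add[OF tendsto_mult[OF tendsto_const e0, of 2]
            tendsto_mult[OF tendsto_const W_res, of 5]] Y_gap] by simp
    \<comment> \<open>The constant 5 is 2 + 3: moving the residual of \<open>J'\<close> from
      \<open>Y n\<close> to \<open>X n\<close> costs twice the distance, and the residual of
      \<open>S\<close> at \<open>Y n\<close> is at most three times that at
      \<open>W n\<close>.\<close>
    have "norm (X n - J' (X n)) \<le> 2 * e n + 5 * norm (W n - S (W n)) + norm (S (Y n) - J' (Y n))"
      for n
    proof -
      have "norm (X n - Y n) \<le> e n + norm (W n - S (W n))"
        using norm_triangle_ineq4[of "X n - W n" "Y n - W n"] XW_le[of n] YW_le[of n] by simp
      moreover have "norm (Y n - S (Y n)) \<le> 3 * norm (W n - S (W n))"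
        using residual_le[OF S_nonexp, of "Y n" "W n"] YW_le[of n] by simp
      moreover have "norm (Y n - J' (Y n)) \<le> norm (Y n - S (Y n)) + norm (S (Y n) - J' (Y n))"
        using norm_triangle_ineq[of "Y n - S (Y n)" "S (Y n) - J' (Y n)"] by simp
      ultimately show ?thesis
        using residual_le[OF J'_nonexp, of "X n" "Y n"] by linarith
    qed
    then show "\<forall>\<^sub>F n in sequentially. norm (X n - J' (X n))
        \<le> 2 * e n + 5 * norm (W n - S (W n)) + norm (S (Y n) - J' (Y n))"
      by (simp add: always_eventually)
  qed simp

  \<comment> \<open>From condition (B) to strong convergence\<close>
  obtain f where f: "mono_on {0..} f" "\<And>r. r > 0 \<Longrightarrow> f r > (0::real)"
    "\<And>z. f (infdist z \<Sigma>) \<le> max (norm (z - S z)) (norm (z - J' z))"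
    using condB unfolding condition_B_def by blast
  have "(\<lambda>n. max (norm (X n - S (X n))) (norm (X n - J' (X n)))) \<longlonglongrightarrow> 0"
    using tendsto_max[OF X_res_S X_res_J] by simp
  then have "(\<lambda>n. infdist (X n) \<Sigma>) \<longlonglongrightarrow> 0"
    using tendsto_zero_of_mono_gauge[where f = f and d = "\<lambda>n. infdist (X n) \<Sigma>", OF f(1,2) infdist_nonneg]
      f(3) by blast
  then have "Cauchy X" using quasi_Fejer_Cauchy Fejer e \<Sigma>_nonempty by blast
  then obtain q where q: "X \<longlonglongrightarrow> q" using Cauchy_convergent convergent_def by blast
  have "q \<in> fixed_points S" "q \<in> fixed_points J'"
    using limit_of_residual_zero_fixed[OF S_nonexp q X_res_S]
      limit_of_residual_zero_fixed[OF J'_nonexp q X_res_J] .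
  moreover have "x \<longlonglongrightarrow> q" using q unfolding X_def by (rule LIMSEQ_imp_Suc)
  ultimately show ?thesis by blast
qed

end
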